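(* Let $X$ be a real normed space and $K\subset X$ a closed convex pointed cone. Let $A,B,C\subset X$ be nonempty sets such that $C$ is $K$-bounded and, for every $\alpha>0$, the set $B+\alpha D_X$ is $K$-convex and $K$-closed. Then $$e(A,B+K)=e(A+C,C+B+K).$$
   Context: Sums of sets are Minkowski sums; $D_X$ is the closed unit ball of $X$. A cone $K$ is pointed if $K\cap(-K)=\{0\}$. For nonempty $A,B\subset X$, the excess from $A$ to $B$ is $e(A,B)=\sup_{x\in A}d(x,B)\in[0,+\infty]$, where $d(x,B)=\inf_{b\in B}\|x-b\|$. A nonempty set $S\subset X$ is $K$-bounded if there is a bounded set $M\subset X$ with $S\subset M+K$; $K$-closed if $S+K$ is closed; $K$-convex if $S+K$ is convex. *)

theory Defs
  imports "HOL-Analysis.Analysis"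
begin

text \<open>Sums of sets are the Minkowski sums of \<^theory>\<open>HOL-Library.Set_Algebras\<close>.
  The unary minus on sets is the complement, so the reflected set is written as an image
  under \<^const>\<open>uminus\<close>.\<close>

definition pointed :: "'a::real_vector set \<Rightarrow> bool"
  where "pointed K \<longleftrightarrow> K \<inter> uminus ` K = {0}"

text \<open>The supremum is taken in \<^typ>\<open>ennreal\<close>, so the excess may be infinite. For nonempty
  \<open>B\<close>, \<^term>\<open>infdist x B\<close> is the usual distance; only nonempty sets are intended.\<close>

definition excess :: "'a::real_normed_vector set \<Rightarrow> 'a set \<Rightarrow> ennreal"
  where "excess A B = (SUP x\<in>A. ennreal (infdist x B))"

definition cone_bounded :: "'a::real_normed_vector set \<Rightarrow> 'a set \<Rightarrow> bool"
  where "cone_bounded K S \<longleftrightarrow> S \<noteq> {} \<and> (\<exists>M. bounded M \<and> S \<subseteq> M + K)"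

definition cone_closed :: "'a::real_normed_vector set \<Rightarrow> 'a set \<Rightarrow> bool"
  where "cone_closed K S \<longleftrightarrow> S \<noteq> {} \<and> closed (S + K)"

definition cone_convex :: "'a::real_normed_vector set \<Rightarrow> 'a set \<Rightarrow> bool"
  where "cone_convex K S \<longleftrightarrow> S \<noteq> {} \<and> convex (S + K)"

end

theory Submission
  imports Defs
begin

text \<open>Adding \<open>c \<in> C\<close> to both arguments does not increase distances, which gives one inequality.
  For the other, if \<open>r\<close> exceeds the right-hand excess, then \<open>a + C \<subseteq> C + Q\<close> for every \<open>a \<in> A\<close>, where
  \<open>Q = B + r D + K\<close> is closed, convex and absorbs \<open>K\<close>. Iterating this inclusion from \<open>c\<^sub>0 \<in> C\<close> yields
  \<open>n a + c\<^sub>0 = c\<^sub>n + n q\<^sub>n\<close> with \<open>c\<^sub>n \<in> C\<close> and \<open>q\<^sub>n \<in> Q\<close>. Writing \<open>c\<^sub>n = m\<^sub>n + k\<^sub>n\<close> with \<open>m\<^sub>n\<close> bounded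
  and \<open>k\<^sub>n \<in> K\<close>, the points \<open>a - (m\<^sub>n - c\<^sub>0) / n = q\<^sub>n + k\<^sub>n / n\<close> of \<open>Q\<close> converge to \<open>a\<close>, so \<open>a \<in> Q\<close>.\<close>

lemma translate_iterate:
  fixes C Q :: "'a::real_vector set"
  assumes "convex Q" and "c0 \<in> C" and trans: "\<And>c. c \<in> C \<Longrightarrow> a + c \<in> C + Q"
  shows "\<exists>c\<in>C. \<exists>q\<in>Q. real (Suc n) *\<^sub>R a + c0 = c + real (Suc n) *\<^sub>R q"
proof (induction n)
  case 0
  from trans[OF \<open>c0 \<in> C\<close>] show ?case
    by (auto elim!: set_plus_elim)
next
  case (Suc n)
  then obtain c q where c: "c \<in> C" "q \<in> Q"
    and eq: "real (Suc n) *\<^sub>R a + c0 = c + real (Suc n) *\<^sub>R q" by blast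
  from trans[OF \<open>c \<in> C\<close>] obtain c' q' where c': "c' \<in> C" "q' \<in> Q" "a + c = c' + q'"
    by (auto elim!: set_plus_elim)
  \<comment> \<open>\<open>p\<close> averages the \<open>n + 1\<close> copies of \<open>q\<close>
    with the one new point \<open>q'\<close>; convexity then keeps the accumulated sum a multiple of
    a single point of \<open>Q\<close>.\<close>
  define p where "p = (real (Suc n) / real (Suc (Suc n))) *\<^sub>R q + (1 / real (Suc (Suc n))) *\<^sub>R q'"
  have "p \<in> Q"
    unfolding p_def using \<open>convex Q\<close> c(2) c'(2)
    by (rule convexD) (simp_all add: field_simps)
  have p: "real (Suc (Suc n)) *\<^sub>R p = real (Suc n) *\<^sub>R q + q'"
    unfolding p_def scaleR_add_right scaleR_scaleR by simp
  have "real (Suc (Suc n)) *\<^sub>R a + c0 = a + (real (Suc n) *\<^sub>R a + c0)"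
    by (simp add: algebra_simps scaleR_2)
  also have "\<dots> = (a + c) + real (Suc n) *\<^sub>R q"
    unfolding eq by (simp only: add.assoc)
  also have "\<dots> = c' + real (Suc (Suc n)) *\<^sub>R p"
    unfolding c'(3) p by (simp only: ac_simps)
  finally show ?case
    using \<open>c' \<in> C\<close> \<open>p \<in> Q\<close> by blast
qed

text \<open>A cancellation law of Radstrom type, striking \<open>C\<close> from
  \<open>a + C \<subseteq> C + Q\<close>. That \<open>C\<close> may be unbounded along
  \<open>K\<close> does no harm, because \<open>Q\<close> absorbs the part in \<open>K\<close>,
  while division by \<open>n\<close> makes the bounded part vanish in the limit.\<close>

lemma order_cancellation:
  fixes C K M Q :: "'a::real_normed_vector set"
  assumes "closed Q" and "convex Q" and "cone K" and "Q + K \<subseteq> Q"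
    and "C \<noteq> {}" and "bounded M" and "C \<subseteq> M + K"
    and trans: "\<And>c. c \<in> C \<Longrightarrow> a + c \<in> C + Q"
  shows "a \<in> Q"
proof -
  obtain c0 where "c0 \<in> C" using \<open>C \<noteq> {}\<close> by blast
  obtain b where b: "\<And>m. m \<in> M \<Longrightarrow> norm m \<le> b"
    using \<open>bounded M\<close> by (auto simp: bounded_iff)
  have "\<exists>m\<in>M. a - (1 / real (Suc n)) *\<^sub>R (m - c0) \<in> Q" for n
  proof -
    obtain c q where "c \<in> C" "q \<in> Q"
      and eq: "real (Suc n) *\<^sub>R a + c0 = c + real (Suc n) *\<^sub>R q"
      using translate_iterate[OF \<open>convex Q\<close> \<open>c0 \<in> C\<close> trans] by blast
    obtain m k where "m \<in> M" "k \<in> K" "c = m + k"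
      using \<open>c \<in> C\<close> \<open>C \<subseteq> M + K\<close> by (blast elim: set_plus_elim)
    have "real (Suc n) *\<^sub>R a - (m - c0) = real (Suc n) *\<^sub>R q + k"
      using eq \<open>c = m + k\<close> by (simp add: algebra_simps)
    then have "(1 / real (Suc n)) *\<^sub>R (real (Suc n) *\<^sub>R a - (m - c0))
        = (1 / real (Suc n)) *\<^sub>R (real (Suc n) *\<^sub>R q + k)" by simp
    then have "a - (1 / real (Suc n)) *\<^sub>R (m - c0) = q + (1 / real (Suc n)) *\<^sub>R k"
      unfolding scaleR_diff_right[of _ _ "m - c0"] scaleR_add_right scaleR_scaleR by simp
    moreover have "(1 / real (Suc n)) *\<^sub>R k \<in> K"
      using \<open>cone K\<close> \<open>k \<in> K\<close> by (simp add: cone_def)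
    ultimately show ?thesis
      using \<open>q \<in> Q\<close> \<open>m \<in> M\<close> \<open>Q + K \<subseteq> Q\<close> by (metis set_plus_intro subsetD)
  qed
  then obtain m where m: "\<And>n. m n \<in> M"
    and inQ: "\<And>n. a - (1 / real (Suc n)) *\<^sub>R (m n - c0) \<in> Q" by metis
  have "norm (m n - c0) \<le> b + norm c0" for n
    using norm_triangle_ineq4[of "m n" c0] b[OF m[of n]] by linarith
  then have "Bseq (\<lambda>n. m n - c0)" by (rule BseqI')
  moreover have "Zfun (\<lambda>n. 1 / real (Suc n)) sequentially"
    using LIMSEQ_inverse_real_of_nat by (simp add: tendsto_Zfun_iff inverse_eq_divide)
  ultimately have "(\<lambda>n. (1 / real (Suc n)) *\<^sub>R (m n - c0)) \<longlonglongrightarrow> 0"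
    unfolding tendsto_Zfun_iff
    using bounded_bilinear.Zfun_prod_Bfun[OF bounded_bilinear_scaleR] by simp
  from tendsto_diff[OF tendsto_const this, of a]
  have "(\<lambda>n. a - (1 / real (Suc n)) *\<^sub>R (m n - c0)) \<longlonglongrightarrow> a" by simp
  with \<open>closed Q\<close> inQ show ?thesis
    by (rule closed_sequentially)
qed

text \<open>The infimum need not be attained, hence the strict inequality.\<close>

lemma infdist_less_obtain:
  assumes "S \<noteq> {}" and "infdist x S < r"
  obtains s where "s \<in> S" "dist x s < r"
proof -
  have "(INF s\<in>S. dist x s) < r"
    using assms by (simp add: infdist_notempty)
  from cInf_lessD[OF _ this] show thesis
    using \<open>S \<noteq> {}\<close> that by auto
qed

text \<open>Translates between the balls in the hypotheses on \<open>B\<close> and distances: the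
  translated ball \<open>s + r D\<close> is the closed ball of radius \<open>r\<close> around
  \<open>s\<close>. Both directions are used below.\<close>

lemma mem_plus_scaled_cball_iff:
  fixes S :: "'a::real_normed_vector set"
  assumes "r > 0"
  shows "x \<in> S + (\<lambda>x. r *\<^sub>R x) ` cball 0 1 \<longleftrightarrow> (\<exists>s\<in>S. dist x s \<le> r)"
proof -
  have "(\<lambda>x. r *\<^sub>R x) ` cball 0 1 = (cball 0 r :: 'a set)"
    using cball_scale[of r 0 1] assms by simp
  then have "x \<in> S + (\<lambda>x. r *\<^sub>R x) ` cball 0 1 \<longleftrightarrow> (\<exists>s\<in>S. \<exists>y. norm y \<le> r \<and> x = s + y)"
    by (force simp: set_plus_def)
  also have "\<dots> \<longleftrightarrow> (\<exists>s\<in>S. dist x s \<le> r)"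
    by (metis add_diff_cancel_left' add_diff_eq dist_norm diff_add_eq add.commute)
  finally show ?thesis .
qed

lemma excess_plus_le:
  fixes A B C :: "'a::real_normed_vector set"
  assumes "B \<noteq> {}"
  shows "excess (A + C) (C + B) \<le> excess A B"
  unfolding excess_def
proof (rule SUP_least)
  fix x assume "x \<in> A + C"
  then obtain a c where ac: "a \<in> A" "c \<in> C" "x = a + c" by (auto elim: set_plus_elim)
  \<comment> \<open>The competitor \<open>c + b\<close> is exactly as far from \<open>a + c\<close>
    as \<open>b\<close> is from \<open>a\<close>.\<close>
  have "infdist x (C + B) \<le> dist a b" if "b \<in> B" for b
    using infdist_le[of "c + b" "C + B" x] ac that
    by (auto simp: dist_norm algebra_simps intro: set_plus_intro)
  then have "infdist x (C + B) \<le> infdist a B"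
    unfolding infdist_notempty[OF \<open>B \<noteq> {}\<close>, of a] using \<open>B \<noteq> {}\<close> by (intro cINF_greatest) auto
  then show "ennreal (infdist x (C + B)) \<le> (SUP x\<in>A. ennreal (infdist x B))"
    using \<open>a \<in> A\<close> by (intro SUP_upper2[of a] ennreal_leI)
qed

theorem proposition3p6:
  fixes K A B C :: "'a::real_normed_vector set"
  assumes "cone K" and "closed K" and "convex K" and "pointed K"
    and "A \<noteq> {}" and "B \<noteq> {}" and "C \<noteq> {}"
    and "cone_bounded K C"
    and "\<And>\<alpha>::real. \<alpha> > 0 \<Longrightarrow> cone_convex K (B + (\<lambda>x. \<alpha> *\<^sub>R x) ` cball 0 1)"
    and "\<And>\<alpha>::real. \<alpha> > 0 \<Longrightarrow> cone_closed K (B + (\<lambda>x. \<alpha> *\<^sub>R x) ` cball 0 1)"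
  shows "excess A (B + K) = excess (A + C) (C + B + K)"
proof (rule antisym)
  \<comment> \<open>The empty set satisfies \<open>cone\<close> as well; pointedness supplies the
    apex. The sums below are then nonempty, so \<open>infdist\<close> is a true infimum and not its
    default value 0.\<close>
  have "0 \<in> K" using \<open>pointed K\<close> by (auto simp: pointed_def)
  have KK: "K + K \<subseteq> K"
    using \<open>cone K\<close> \<open>convex K\<close> by (blast elim: set_plus_elim dest: convex_cone[THEN iffD1, OF conjI])
  have ne: "B + K \<noteq> {}" "C + B + K \<noteq> {}"
    using \<open>B \<noteq> {}\<close> \<open>C \<noteq> {}\<close> \<open>0 \<in> K\<close> by (auto simp: set_plus_def)
  show "excess (A + C) (C + B + K) \<le> excess A (B + K)"
    using excess_plus_le[OF ne(1), of A C] by (simp only: add.assoc)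
  show "excess A (B + K) \<le> excess (A + C) (C + B + K)"
  proof (cases "excess (A + C) (C + B + K)")
    case (real e)
    have "infdist a (B + K) \<le> e" if "a \<in> A" for a
    \<comment> \<open>The slack \<open>r > e\<close> serves twice: the radius is positive even when
      \<open>e = 0\<close>, so the hypotheses on \<open>B\<close> apply, and a point of
      \<open>C + B + K\<close> closer than \<open>r\<close> exists although the infimum may not be
      attained.\<close>
    proof (rule dense_ge)
      fix r assume "e < r"
      with real have "r > 0" by simp
      define D where "D = (\<lambda>x. r *\<^sub>R x) ` cball (0::'a) 1"
      define Q where "Q = B + D + K"
      obtain M where M: "bounded M" "C \<subseteq> M + K"
        using \<open>cone_bounded K C\<close> by (auto simp: cone_bounded_def)
      have "a \<in> Q"
      proof (rule order_cancellation[OF _ _ \<open>cone K\<close> _ \<open>C \<noteq> {}\<close> M])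
        show "closed Q" "convex Q"
          using assms(9,10)[OF \<open>r > 0\<close>] by (simp_all add: Q_def D_def cone_convex_def cone_closed_def)
        show "Q + K \<subseteq> Q"
          unfolding Q_def add.assoc[of _ K K] by (intro set_plus_mono2 KK order_refl)
        fix c assume "c \<in> C"
        then have "ennreal (infdist (a + c) (C + B + K)) \<le> ennreal e"
          unfolding real(2)[symmetric] excess_def using \<open>a \<in> A\<close>
          by (intro SUP_upper set_plus_intro)
        then have "infdist (a + c) (C + B + K) < r"
          using real(1) \<open>e < r\<close> by (simp add: ennreal_le_iff)
        then obtain s where "s \<in> C + B + K" "dist (a + c) s < r"
          using infdist_less_obtain[OF ne(2)] by blast
        \<comment> \<open>Regrouping the summands moves the ball next to \<open>B\<close>, which
          isolates \<open>C\<close> for cancellation.\<close>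
        then have "a + c \<in> C + B + K + D"
          unfolding D_def mem_plus_scaled_cball_iff[OF \<open>r > 0\<close>] by force
        then show "a + c \<in> C + Q"
          by (simp only: Q_def ac_simps)
      qed
      then have "a \<in> (B + K) + D"
        by (simp only: Q_def ac_simps)
      then obtain s where "s \<in> B + K" "dist a s \<le> r"
        unfolding D_def mem_plus_scaled_cball_iff[OF \<open>r > 0\<close>] by blast
      then show "infdist a (B + K) \<le> r"
        by (rule infdist_le2)
    qed
    then show ?thesis
      unfolding real(2) unfolding excess_def by (intro SUP_least ennreal_leI)
  qed simp
qed

end
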